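(* Let $n\ge1$ and let $G$ be an abelian subgroup of $GL(n,\mathbb{C})$ (resp. of $GL(n,\mathbb{R})$). Then every orbit of $G$ in $\mathbb{C}^n$ (resp. in $\mathbb{R}^n$) is regular with some order $m$ satisfying $0\le m\le 2n$ (resp. $0\le m\le n$).
   Context: Let $\mathbb{K}=\mathbb{C}$ or $\mathbb{R}$. $G\subset GL(n,\mathbb{K})$ acts on $\mathbb{K}^n$ by $(A,v)\mapsto Av$ and the orbit of $u$ is $G(u)=\{Au:A\in G\}$. An orbit $\gamma$ is regular with order $m$ if for every $v\in\gamma$ there is an open set $O$ of $\mathbb{K}^n$ containing $v$ such that $\overline{\gamma}\cap O$ is a manifold of dimension $m$ over $\mathbb{R}$. The order may depend on the orbit. *)

theory Defs
  imports "HOL-Analysis.Analysis" "HOL-Algebra.Group"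
begin

definition general_linear :: "('k::field ^ 'n ^ 'n) monoid" where
  "general_linear = \<lparr>carrier = {A. invertible A}, monoid.mult = (**), one = mat 1\<rparr>"

lemma group_general_linear: "group (general_linear :: ('k::field ^ 'n ^ 'n) monoid)"
proof (rule groupI)
  fix A B :: "'k ^ 'n ^ 'n"
  assume "A \<in> carrier general_linear" "B \<in> carrier general_linear"
  then show "A \<otimes>\<^bsub>general_linear\<^esub> B \<in> carrier general_linear"
    by (simp add: general_linear_def invertible_mult)
next
  fix A :: "'k ^ 'n ^ 'n"
  assume "A \<in> carrier general_linear"
  then show "\<exists>B\<in>carrier general_linear. B \<otimes>\<^bsub>general_linear\<^esub> A = \<one>\<^bsub>general_linear\<^esub>"
    unfolding general_linear_def invertible_def by auto
qed (auto simp: general_linear_def matrix_mul_assoc invertible_def intro: exI[of _ "mat 1"])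

definition orbit :: "('k::field ^ 'n ^ 'n) set \<Rightarrow> 'k ^ 'n \<Rightarrow> ('k ^ 'n) set" where
  "orbit G u = {A *v u | A. A \<in> G}"

text \<open>For open \<open>U\<close> and finite-dimensional \<open>'a\<close> the following is the usual class \<open>C\<^sup>k\<close>.
  The iterated derivatives are taken in fixed directions \<open>v\<close>, so that they all have the type of
  \<open>f\<close>; in finite dimension, continuity of the derivative in every direction is the
  same as continuity of the derivative as a linear map.\<close>

primrec Ck_on :: "nat \<Rightarrow> 'a set \<Rightarrow> ('a::real_normed_vector \<Rightarrow> 'b::real_normed_vector) \<Rightarrow> bool" where
  "Ck_on 0 U f \<longleftrightarrow> continuous_on U f"
| "Ck_on (Suc k) U f \<longleftrightarrow>
     (\<forall>x\<in>U. f differentiable (at x)) \<and>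
     (\<forall>v. Ck_on k U (\<lambda>x. frechet_derivative f (at x) v))"

definition smooth_on :: "'a set \<Rightarrow> ('a::real_normed_vector \<Rightarrow> 'b::real_normed_vector) \<Rightarrow> bool" where
  "smooth_on U f \<longleftrightarrow> (\<forall>k. Ck_on k U f)"

text \<open>A subset of a Euclidean space is a manifold of dimension \<open>m\<close> if it is a smooth embedded
  submanifold: near each of its points some diffeomorphism between open sets of the ambient space
  carries it to a linear subspace of dimension \<open>m\<close>. Here \<open>subspace\<close> and
  \<open>dim\<close> are those of the underlying real vector space, also for \<open>complex ^ 'n\<close>.\<close>

definition manifold_of_dim :: "nat \<Rightarrow> 'a::euclidean_space set \<Rightarrow> bool" where
  "manifold_of_dim m M \<longleftrightarrow>
     (\<forall>p\<in>M. \<exists>U V S (h :: 'a \<Rightarrow> 'a) h'.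
        open U \<and> p \<in> U \<and> open V \<and>
        homeomorphism U V h h' \<and> smooth_on U h \<and> smooth_on V h' \<and>
        subspace S \<and> dim S = m \<and> h ` (U \<inter> M) = V \<inter> S)"

definition regular_of_order :: "nat \<Rightarrow> 'a::euclidean_space set \<Rightarrow> bool" where
  "regular_of_order m \<gamma> \<longleftrightarrow>
     (\<forall>v\<in>\<gamma>. \<exists>W. open W \<and> v \<in> W \<and> manifold_of_dim m (closure \<gamma> \<inter> W))"

end

theory Submission
  imports Defs
begin

text \<open>Let \<open>A\<close> be the real span of the abelian group \<open>G\<close>, a commutative algebra of endomorphisms, and let
  \<open>E = A u\<close>. Evaluation at \<open>u\<close> identifies the restriction of \<open>A\<close> to \<open>E\<close> with \<open>E\<close>: if \<open>a u = 0\<close> then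
  \<open>a b u = b a u = 0\<close> for all \<open>b\<close> in \<open>A\<close>. Under this identification the orbit of \<open>u\<close> is the image of \<open>G\<close>,
  a subgroup of the group of units of a commutative algebra, and such a subgroup is described near 1
  by its logarithms.

  In detail, \<open>exp\<close> is a local diffeomorphism at 0 and turns addition into multiplication, so the
  vectors \<open>x\<close> in \<open>E\<close> whose exponential, evaluated at \<open>u\<close>, lies in the orbit form an additive group
  (\<open>log_orb_diff\<close>). Its closure is a closed subgroup of a Euclidean space and therefore coincides with
  a linear subspace near 0 (\<open>closed_subgroup_subspace_near_0\<close>). Hence the logarithm flattens the closure
  of the orbit near \<open>u\<close> (\<open>chart_at_base_point\<close>). The elements of \<open>G\<close> carry this one chart to all other
  points of the orbit (\<open>abelian_endo_group_orbit_regular\<close>).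

  The chart has to be a smooth diffeomorphism of open sets of the ambient space. It is the local
  inverse, given by the inverse function theorem, of \<open>x \<mapsto> exp (M x) u + (x - M x u)\<close>, where \<open>M\<close> is a
  linear choice of preimages under evaluation, so that \<open>x \<mapsto> M x u\<close> is a projection onto \<open>E\<close>. The
  smoothness of the inverse is read off from its derivative (\<open>smooth_on_inverse\<close>). Only the real
  linear structure enters, which is why real and complex matrices are treated together.\<close>

section \<open>Functions of class \<open>C\<^sup>k\<close>\<close>

text \<open>On an open set the derivatives of \<open>f\<close> depend only on the values of \<open>f\<close> there; this is what
  allows a formula for the derivative that is valid only inside \<open>U\<close> to be used in the recursion.\<close>

lemma Ck_on_cong:
  assumes "open U" "\<And>x. x \<in> U \<Longrightarrow> g x = f x" "Ck_on k U f"
  shows "Ck_on k U g"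
  using assms(2,3)
proof (induction k arbitrary: f g)
  case 0
  have "continuous_on U f" using 0(2) by simp
  then have "continuous_on U g" by (rule continuous_on_eq) (rule 0(1)[symmetric])
  then show ?case by simp
next
  case (Suc k)
  have der: "(g has_derivative frechet_derivative f (at x)) (at x)" if "x \<in> U" for x
  proof -
    have "(f has_derivative frechet_derivative f (at x)) (at x)"
      using Suc.prems(2) that by (auto simp: frechet_derivative_works[symmetric])
    then show ?thesis
      by (rule has_derivative_transform_within_open[OF _ \<open>open U\<close> that])
        (rule Suc.prems(1)[symmetric])
  qed
  have eq: "frechet_derivative g (at x) = frechet_derivative f (at x)" if "x \<in> U" for x
    using frechet_derivative_at[OF der[OF that]] by simp
  have "Ck_on k U (\<lambda>x. frechet_derivative g (at x) v)" for v
  proof (rule Suc.IH)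
    show "frechet_derivative g (at x) v = frechet_derivative f (at x) v" if "x \<in> U" for x
      by (simp only: eq[OF that])
    show "Ck_on k U (\<lambda>x. frechet_derivative f (at x) v)"
      using Suc.prems(2) by simp
  qed
  moreover have "g differentiable (at x)" if "x \<in> U" for x
    using der[OF that] by (rule differentiableI)
  ultimately show ?case by simp
qed

text \<open>The form in which the recursion is used below: an explicit derivative replaces the choice
  operator hidden in \<^const>\<open>frechet_derivative\<close>.\<close>

lemma Ck_on_Suc_has_derivativeI:
  assumes "open U" and der: "\<And>x. x \<in> U \<Longrightarrow> (f has_derivative f' x) (at x)"
    and "\<And>v. Ck_on k U (\<lambda>x. f' x v)"
  shows "Ck_on (Suc k) U f"
proof -
  have "frechet_derivative f (at x) = f' x" if "x \<in> U" for x
    using frechet_derivative_at[OF der[OF that]] by simp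
  then have "Ck_on k U (\<lambda>x. frechet_derivative f (at x) v)" for v
    by (intro Ck_on_cong[OF \<open>open U\<close> _ assms(3)]) auto
  with der show ?thesis
    by (auto simp: differentiable_def)
qed

lemma Ck_on_subset: "Ck_on k U f \<Longrightarrow> W \<subseteq> U \<Longrightarrow> Ck_on k W f"
proof (induction k arbitrary: f)
  case 0
  then show ?case using continuous_on_subset by simp
next
  case (Suc k)
  then show ?case by auto
qed

lemma Ck_on_const: "Ck_on k U (\<lambda>x. c)"
  by (induction k arbitrary: c) (auto simp: frechet_derivative_const)

lemma Ck_on_bounded_linear: "bounded_linear A \<Longrightarrow> Ck_on k U A"
proof (induction k)
  case 0
  then show ?case by (simp add: linear_continuous_on)
next
  case (Suc k)
  then have "frechet_derivative A (at x) = A" for x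
    using frechet_derivative_at[OF bounded_linear_imp_has_derivative[OF Suc.prems], of x] by simp
  with Suc.prems show ?case
    by (simp add: Ck_on_const bounded_linear_imp_differentiable)
qed

lemma Ck_on_add:
  assumes "open U" "Ck_on k U f" "Ck_on k U g"
  shows "Ck_on k U (\<lambda>x. f x + g x)"
  using assms(2,3)
proof (induction k arbitrary: f g)
  case 0
  then show ?case by (simp add: continuous_on_add)
next
  case (Suc k)
  show ?case
  proof (rule Ck_on_Suc_has_derivativeI[OF \<open>open U\<close>])
    fix x assume "x \<in> U"
    with Suc.prems show "((\<lambda>x. f x + g x) has_derivative
        (\<lambda>v. frechet_derivative f (at x) v + frechet_derivative g (at x) v)) (at x)"
      by (auto intro!: has_derivative_add simp: frechet_derivative_works[symmetric])
  qed (use Suc in auto)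
qed

lemma Ck_on_bounded_linear_compose:
  assumes "open U" "bounded_linear A" "Ck_on k U f"
  shows "Ck_on k U (\<lambda>x. A (f x))"
  using assms(3)
proof (induction k arbitrary: f)
  case 0
  then show ?case by (simp add: bounded_linear.continuous_on[OF assms(2)])
next
  case (Suc k)
  show ?case
  proof (rule Ck_on_Suc_has_derivativeI[OF \<open>open U\<close>])
    fix x assume "x \<in> U"
    with Suc.prems show "((\<lambda>x. A (f x)) has_derivative
        (\<lambda>v. A (frechet_derivative f (at x) v))) (at x)"
      by (auto intro!: bounded_linear.has_derivative[OF assms(2)]
          simp: frechet_derivative_works[symmetric])
  qed (use Suc in auto)
qed

lemma Ck_on_compose_bounded_linear:
  assumes "open U" "bounded_linear A" "Ck_on k U f"
  shows "Ck_on k (A -` U) (\<lambda>x. f (A x))"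
  using assms(3)
proof (induction k arbitrary: f)
  case 0
  then show ?case
    by (auto intro!: continuous_on_compose2[of U f] linear_continuous_on[OF assms(2)])
next
  case (Suc k)
  have op: "open (A -` U)"
    using assms(1,2) linear_continuous_on open_vimage by blast
  show ?case
  proof (rule Ck_on_Suc_has_derivativeI[OF op])
    fix x assume "x \<in> A -` U"
    with Suc.prems have "(f has_derivative frechet_derivative f (at (A x))) (at (A x))"
      by (auto simp: frechet_derivative_works[symmetric])
    then show "((\<lambda>x. f (A x)) has_derivative
        (\<lambda>v. frechet_derivative f (at (A x)) (A v))) (at x)"
      using has_derivative_compose[OF bounded_linear_imp_has_derivative[OF assms(2)]] by blast
  qed (use Suc in auto)
qed

section \<open>Closed subgroups of a Euclidean space\<close>

text \<open>The subspace is the union \<open>S\<close> of all lines contained in \<open>T\<close>. If \<open>T\<close> had points outside \<open>S\<close>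
  arbitrarily close to 0, then their components \<open>y\<^sub>n\<close> orthogonal to \<open>S\<close> would be nonzero elements of \<open>T\<close>
  tending to 0. Integer multiples of \<open>y\<^sub>n\<close> then approximate every real multiple of a limit direction
  \<open>z\<close> of the \<open>y\<^sub>n\<close>, so the line through \<open>z\<close> lies in \<open>T\<close>. Hence \<open>z\<close> belongs to \<open>S\<close> and is
  orthogonal to \<open>S\<close>, although \<open>z\<close> is a unit vector.\<close>

lemma closed_subgroup_subspace_near_0:
  fixes T :: "'a::euclidean_space set"
  assumes "closed T" "0 \<in> T" and diff: "\<And>x y. x \<in> T \<Longrightarrow> y \<in> T \<Longrightarrow> x - y \<in> T"
  obtains S e where "subspace S" "0 < e" "T \<inter> ball 0 e = S \<inter> ball 0 e"
proof -
  have uminus_in: "- x \<in> T" if "x \<in> T" for x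
    using diff[OF \<open>0 \<in> T\<close> that] by simp
  have add: "x + y \<in> T" if "x \<in> T" "y \<in> T" for x y
    using diff[OF that(1) uminus_in[OF that(2)]] by simp
  have nat_mult: "of_nat n *\<^sub>R x \<in> T" if "x \<in> T" for x and n :: nat
    using that by (induction n) (auto simp: algebra_simps \<open>0 \<in> T\<close> intro: add)
  have int_mult: "of_int n *\<^sub>R x \<in> T" if "x \<in> T" for x and n :: int
  proof (cases n)
    case (nonneg k)
    then show ?thesis using nat_mult[OF that, of k] by simp
  next
    case (neg k)
    then show ?thesis using uminus_in[OF nat_mult[OF that, of "Suc k"]]
      by (simp flip: scaleR_minus_left)
  qed
  define S where "S = {x. \<forall>t. t *\<^sub>R x \<in> T}"
  have S: "subspace S"
    unfolding subspace_def S_def by (auto simp: \<open>0 \<in> T\<close> scaleR_add_right intro: add)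
  have ST: "S \<subseteq> T"
    unfolding S_def by (auto dest: spec[of _ 1])
  have "\<exists>e>0. T \<inter> ball 0 e \<subseteq> S"
  proof (rule ccontr)
    assume "\<not> ?thesis"
    then have "\<not> T \<inter> ball 0 (inverse (real (Suc n))) \<subseteq> S" for n
      by simp
    then have "\<exists>x. x \<in> T - S \<and> norm x < inverse (real (Suc n))" for n
      by (fastforce simp: subset_iff)
    then obtain x where x: "\<And>n. x n \<in> T - S" "\<And>n. norm (x n) < inverse (real (Suc n))"
      by metis
    have "\<exists>s y. s \<in> S \<and> (\<forall>w\<in>S. orthogonal y w) \<and> x n = s + y" for n
    proof -
      obtain s y where "s \<in> span S" "\<And>w. w \<in> span S \<Longrightarrow> orthogonal y w" "x n = s + y"
        by (rule orthogonal_subspace_decomp_exists[of S "x n"]) blast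
      moreover have "span S = S" using S by (simp add: span_eq_iff)
      ultimately show ?thesis by auto
    qed
    then obtain s y where sy: "\<And>n. s n \<in> S" "\<And>n w. w \<in> S \<Longrightarrow> orthogonal (y n) w"
        "\<And>n. x n = s n + y n"
      by metis
    have yT: "y n \<in> T" for n
      using diff[of "x n" "s n"] x(1)[of n] sy(1,3)[of n] ST by auto
    have y0: "y n \<noteq> 0" for n
      using x(1)[of n] sy(1,3)[of n] by auto
    have y_small: "norm (y n) < inverse (real (Suc n))" for n
    proof -
      have "(norm (x n))\<^sup>2 = (norm (s n))\<^sup>2 + (norm (y n))\<^sup>2"
        unfolding sy(3)[of n] by (rule norm_add_Pythagorean)
          (use sy(2)[OF sy(1), of n n] in \<open>simp add: orthogonal_commute\<close>)
      then have "norm (y n) \<le> norm (x n)"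
        by (intro power2_le_imp_le[OF _ norm_ge_zero]) (use zero_le_power2[of "norm (s n)"] in linarith)
      with x(2)[of n] show ?thesis by simp
    qed
    have y_lim: "(\<lambda>n. norm (y n)) \<longlonglongrightarrow> 0"
      by (rule tendsto_sandwich[OF _ _ tendsto_const LIMSEQ_inverse_real_of_nat])
        (use y_small in \<open>auto intro!: always_eventually less_imp_le\<close>)
    have sphere: "\<forall>n. y n /\<^sub>R norm (y n) \<in> sphere 0 1"
      using y0 by simp
    obtain z r where z: "z \<in> sphere 0 1" "strict_mono r"
        "((\<lambda>n. y n /\<^sub>R norm (y n)) \<circ> r) \<longlonglongrightarrow> z"
      using seq_compactE[OF compact_imp_seq_compact[OF compact_sphere] sphere] .
    have "t *\<^sub>R z \<in> T" for t
    proof -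
      \<comment> \<open>\<open>k n * norm (y (r n))\<close> differs from \<open>t\<close> by at most \<open>norm (y (r n))\<close>, which tends to 0\<close>
      define k where "k n = \<lfloor>t / norm (y (r n))\<rfloor>" for n
      have "(\<lambda>n. of_int (k n) * norm (y (r n))) \<longlonglongrightarrow> t"
      proof (rule tendsto_sandwich)
        have "t - norm (y (r n)) \<le> of_int (k n) * norm (y (r n))" for n
        proof -
          have "(t / norm (y (r n)) - 1) * norm (y (r n)) \<le> of_int (k n) * norm (y (r n))"
            unfolding k_def by (intro mult_right_mono norm_ge_zero) linarith
          then show ?thesis using y0[of "r n"] by (simp add: left_diff_distrib)
        qed
        then show "\<forall>\<^sub>F n in sequentially. t - norm (y (r n)) \<le> of_int (k n) * norm (y (r n))"
          by simp
        have "of_int (k n) * norm (y (r n)) \<le> t" for n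
        proof -
          have "of_int (k n) * norm (y (r n)) \<le> t / norm (y (r n)) * norm (y (r n))"
            unfolding k_def by (intro mult_right_mono norm_ge_zero) linarith
          then show ?thesis using y0[of "r n"] by simp
        qed
        then show "\<forall>\<^sub>F n in sequentially. of_int (k n) * norm (y (r n)) \<le> t"
          by simp
        show "(\<lambda>n. t - norm (y (r n))) \<longlonglongrightarrow> t"
          using tendsto_diff[OF tendsto_const LIMSEQ_subseq_LIMSEQ[OF y_lim z(2)], of t]
          by (simp add: o_def)
      qed simp
      from tendsto_scaleR[OF this z(3)]
      have "(\<lambda>n. of_int (k n) *\<^sub>R y (r n)) \<longlonglongrightarrow> t *\<^sub>R z"
        using y0 by (simp add: o_def mult.assoc)
      then show ?thesis
        by (rule closed_sequentially[OF \<open>closed T\<close> int_mult[OF yT]])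
    qed
    then have "z \<in> S" by (simp add: S_def)
    have "y n \<bullet> z = 0" for n
      using sy(2)[OF \<open>z \<in> S\<close>] by (simp add: orthogonal_def)
    with tendsto_inner[OF z(3) tendsto_const[of z]] have "z \<bullet> z = 0"
      by (simp add: o_def LIMSEQ_const_iff)
    with z(1) show False by simp
  qed
  then obtain e where "0 < e" "T \<inter> ball 0 e \<subseteq> S" by blast
  with S ST that show ?thesis by blast
qed

section \<open>The Banach algebra of endomorphisms\<close>

text \<open>A type of its own, because the two type arguments of \<open>'a \<Rightarrow>\<^sub>L 'b\<close> are independent and so the type
  of bounded linear maps cannot itself carry a product. With a product given by composition the
  exponential series and its laws become available for endomorphisms.\<close>

typedef (overloaded) 'a endo = "UNIV :: ('a::{real_normed_vector, perfect_space} \<Rightarrow>\<^sub>L 'a) set"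
  morphisms blinfun_of_endo endo_of_blinfun
  by simp

setup_lifting type_definition_endo

instantiation endo :: ("{real_normed_vector, perfect_space}") real_normed_algebra_1
begin

lift_definition zero_endo :: "'a endo" is 0 .
lift_definition one_endo :: "'a endo" is id_blinfun .
lift_definition plus_endo :: "'a endo \<Rightarrow> 'a endo \<Rightarrow> 'a endo" is "(+)" .
lift_definition minus_endo :: "'a endo \<Rightarrow> 'a endo \<Rightarrow> 'a endo" is "(-)" .
lift_definition uminus_endo :: "'a endo \<Rightarrow> 'a endo" is uminus .
lift_definition times_endo :: "'a endo \<Rightarrow> 'a endo \<Rightarrow> 'a endo" is "(o\<^sub>L)" .
lift_definition scaleR_endo :: "real \<Rightarrow> 'a endo \<Rightarrow> 'a endo" is scaleR .
lift_definition norm_endo :: "'a endo \<Rightarrow> real" is norm .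

definition dist_endo :: "'a endo \<Rightarrow> 'a endo \<Rightarrow> real"
  where "dist_endo a b = norm (a - b)"

definition uniformity_endo :: "('a endo \<times> 'a endo) filter"
  where "uniformity_endo = (INF e\<in>{0<..}. principal {(x, y). dist x y < e})"

definition open_endo :: "'a endo set \<Rightarrow> bool"
  where "open_endo S = (\<forall>x\<in>S. \<forall>\<^sub>F (x', y) in uniformity. x' = x \<longrightarrow> y \<in> S)"

definition sgn_endo :: "'a endo \<Rightarrow> 'a endo"
  where "sgn_endo a = scaleR (inverse (norm a)) a"

instance
proof
  fix a b c :: "'a endo" and r s :: real
  show "a + b + c = a + (b + c)" "a + b = b + a" "0 + a = a" "- a + a = 0" "a - b = a + - b"
    "r *\<^sub>R (a + b) = r *\<^sub>R a + r *\<^sub>R b" "(r + s) *\<^sub>R a = r *\<^sub>R a + s *\<^sub>R a"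
    "r *\<^sub>R s *\<^sub>R a = (r * s) *\<^sub>R a" "1 *\<^sub>R a = a"
    by (transfer, simp add: algebra_simps)+
  show "a * b * c = a * (b * c)" "1 * a = a" "a * 1 = a"
    "(a + b) * c = a * c + b * c" "a * (b + c) = a * b + a * c"
    "r *\<^sub>R a * b = r *\<^sub>R (a * b)" "a * r *\<^sub>R b = r *\<^sub>R (a * b)"
    by (transfer, auto intro!: blinfun_eqI simp: blinfun.bilinear_simps)+
  show "norm a = 0 \<longleftrightarrow> a = 0" "norm (r *\<^sub>R a) = \<bar>r\<bar> * norm a"
    by (transfer, simp)+
  show "norm (a + b) \<le> norm a + norm b"
    by transfer (rule norm_triangle_ineq)
  show "norm (a * b) \<le> norm a * norm b"
    by transfer (rule norm_blinfun_compose)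
  show "norm (1 :: 'a endo) = 1"
    by transfer (rule norm_blinfun_id)
  show "(0 :: 'a endo) \<noteq> 1"
    by transfer (metis norm_blinfun_id norm_zero zero_neq_one)
qed (rule dist_endo_def uniformity_endo_def open_endo_def sgn_endo_def)+

end

lemma bounded_linear_blinfun_of_endo: "bounded_linear blinfun_of_endo"
  by (rule bounded_linear_intro[where K = 1]) (transfer; simp)+

lemma bounded_linear_endo_of_blinfun: "bounded_linear endo_of_blinfun"
  by (rule bounded_linear_intro[where K = 1])
    (simp_all add: plus_endo.abs_eq scaleR_endo.abs_eq norm_endo.abs_eq)

instance endo :: ("{banach, perfect_space}") banach
proof
  fix X :: "nat \<Rightarrow> 'a endo"
  assume "Cauchy X"
  then have "Cauchy (\<lambda>n. blinfun_of_endo (X n))"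
    by (rule bounded_linear.Cauchy[OF bounded_linear_blinfun_of_endo])
  then obtain L where "(\<lambda>n. blinfun_of_endo (X n)) \<longlonglongrightarrow> L"
    by (auto simp: Cauchy_convergent_iff convergent_def)
  from bounded_linear.tendsto[OF bounded_linear_endo_of_blinfun this]
  show "convergent X"
    by (auto simp: convergent_def blinfun_of_endo_inverse)
qed

lift_definition app :: "'a::{real_normed_vector, perfect_space} endo \<Rightarrow> 'a \<Rightarrow> 'a"
  is blinfun_apply .

lemma bounded_bilinear_app: "bounded_bilinear app"
proof -
  have "bounded_bilinear (\<lambda>a. blinfun_apply (blinfun_of_endo a))"
    by (rule bounded_bilinear.comp1[OF bounded_bilinear_blinfun_apply bounded_linear_blinfun_of_endo])
  then show ?thesis by (simp add: app.rep_eq[abs_def])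
qed

interpretation app: bounded_bilinear app
  by (rule bounded_bilinear_app)

declare app.zero_left [simp] app.zero_right [simp]

lemma app_mult [simp]: "app (a * b) x = app a (app b x)"
  by transfer simp

lemma app_one [simp]: "app 1 x = x"
  by transfer simp

lemma endo_eqI: "(\<And>x. app a x = app b x) \<Longrightarrow> a = b"
  by transfer (rule blinfun_eqI)

section \<open>The exponential function of a Banach algebra\<close>

lemma exp_commute:
  fixes a b :: "'a::{real_normed_algebra_1, banach}"
  assumes "a * b = b * a"
  shows "exp a * b = b * exp a"
  by (simp add: exp_def suminf_mult[symmetric] suminf_mult2 summable_exp_generic
      power_commuting_commutes[OF assms])

text \<open>The remainder \<open>exp h - 1 - h\<close> is dominated term by term by the same remainder of the real
  exponential series at \<open>norm h\<close>, so differentiability at 0 is inherited from the reals.\<close>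

lemma has_derivative_exp_0:
  "(exp has_derivative (\<lambda>h. h)) (at (0 :: 'a::{real_normed_algebra_1, banach}))"
  unfolding has_derivative_at
proof
  have le: "norm (exp h - 1 - h) \<le> exp (norm h) - 1 - norm h" for h :: 'a
  proof -
    have sum: "summable (\<lambda>n. norm (h ^ (n + 2)) /\<^sub>R fact (n + 2))"
      using summable_ignore_initial_segment[OF summable_norm_exp[of h], of 2] by simp
    have sum': "summable (\<lambda>n. norm h ^ (n + 2) /\<^sub>R fact (n + 2))"
      by (rule summable_ignore_initial_segment[OF summable_exp_generic])
    have "norm (exp h - 1 - h) = norm (\<Sum>n. h ^ (n + 2) /\<^sub>R fact (n + 2))"
      by (simp add: exp_first_two_terms[of h])
    also have "\<dots> \<le> (\<Sum>n. norm (h ^ (n + 2) /\<^sub>R fact (n + 2)))"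
      by (rule summable_norm) (use sum in \<open>simp add: abs_mult\<close>)
    also have "\<dots> \<le> (\<Sum>n. norm h ^ (n + 2) /\<^sub>R fact (n + 2))"
      by (rule suminf_le) (use sum sum' norm_power_ineq[of h] in
          \<open>auto simp: intro!: mult_left_mono simp del: power_Suc\<close>)
    also have "\<dots> = exp (norm h) - 1 - norm h"
      by (simp add: exp_first_two_terms[of "norm h"])
    finally show ?thesis .
  qed
  have "((\<lambda>t::real. (exp t - 1 - t) / t) \<longlongrightarrow> 0) (at 0)"
  proof (rule Lim_transform_eventually)
    show "((\<lambda>t. (exp (0 + t) - exp 0) / t - 1) \<longlongrightarrow> 0) (at (0::real))"
      using tendsto_diff[OF DERIV_D[OF DERIV_exp[of "0::real"]] tendsto_const[of 1]] by simp
    show "\<forall>\<^sub>F t::real in at 0. (exp (0 + t) - exp 0) / t - 1 = (exp t - 1 - t) / t"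
      by (auto simp: eventually_at_filter field_simps)
  qed
  then have "((\<lambda>h::'a. (exp (norm h) - 1 - norm h) / norm h) \<longlongrightarrow> 0) (at 0)"
  proof (rule filterlim_compose)
    show "filterlim norm (at 0) (at (0::'a))"
      by (rule filterlim_atI) (auto intro: tendsto_norm_zero simp: eventually_at_filter)
  qed
  then show "((\<lambda>h::'a. norm (exp (0 + h) - exp 0 - h) / norm h) \<longlongrightarrow> 0) (at 0)"
    by (rule tendsto_sandwich[OF _ _ tendsto_const, rotated 2])
      (auto intro!: always_eventually divide_right_mono le)
qed (rule bounded_linear_ident)

text \<open>Along a commuting family \<open>exp (M y) = exp (M x) * exp (M (y - x))\<close>, which moves the
  derivative at \<open>x\<close> to the derivative at 0.\<close>

lemma has_derivative_exp_commuting: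
  fixes M :: "'a::real_normed_vector \<Rightarrow> 'b::{real_normed_algebra_1, banach}"
  assumes "bounded_linear M" and comm: "\<And>x y. M x * M y = M y * M x"
  shows "((\<lambda>x. exp (M x)) has_derivative (\<lambda>v. exp (M x) * M v)) (at x)"
proof -
  interpret M: bounded_linear M by fact
  have "((\<lambda>y. M (y - x)) has_derivative M) (at x)"
    by (rule has_derivative_eq_rhs[OF M.has_derivative]) (auto intro!: derivative_eq_intros)
  from has_derivative_compose[OF this, of exp "\<lambda>h. h"]
  have "((\<lambda>y. exp (M x) * exp (M (y - x))) has_derivative (\<lambda>v. exp (M x) * M v)) (at x)"
    using has_derivative_exp_0 by (auto intro!: has_derivative_mult_right)
  moreover have "exp (M x) * exp (M (y - x)) = exp (M y)" for y
    using exp_add_commuting[OF comm, of x "y - x"] by (simp flip: M.add)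
  ultimately show ?thesis by simp
qed

section \<open>The logarithmic chart of an abelian orbit\<close>

text \<open>The real span of \<open>G\<close> is a commutative algebra. Evaluation at \<open>u\<close> maps it onto the smallest
  \<open>G\<close>-invariant subspace containing \<open>u\<close>, and \<open>M\<close> chooses linearly, for each vector of that subspace,
  an element of the algebra that evaluates to it. The map \<open>M\<close> is total on the ambient space, so that
  a chart of the whole space can be written down and not only one of the subspace.\<close>

locale abelian_orbit =
  fixes G :: "'a::euclidean_space endo set" and u :: 'a and M :: "'a \<Rightarrow> 'a endo"
  assumes one_in: "1 \<in> G"
    and mult_in: "g \<in> G \<Longrightarrow> h \<in> G \<Longrightarrow> g * h \<in> G"
    and inverse_in: "g \<in> G \<Longrightarrow> \<exists>h\<in>G. h * g = 1"
    and commute: "g \<in> G \<Longrightarrow> h \<in> G \<Longrightarrow> g * h = h * g"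
    and linear_M: "linear M"
    and M_in: "M x \<in> span G"
    and M_right_inverse: "a \<in> span G \<Longrightarrow> app (M (app a u)) u = app a u"
begin

definition orb :: "'a set"
  where "orb = (\<lambda>g. app g u) ` G"

definition cyclic_space :: "'a set"
  where "cyclic_space = (\<lambda>a. app a u) ` span G"

lemma span_commute:
  assumes "a \<in> span G" "b \<in> span G"
  shows "a * b = b * a"
proof -
  have g: "g * b = b * g" if "g \<in> G" for g
    using assms(2)
    by (induction rule: span_induct_alt) (auto simp: algebra_simps commute[OF that])
  show ?thesis
    using assms(1)
    by (induction rule: span_induct_alt) (auto simp: algebra_simps g)
qed

lemma span_mult:
  assumes "a \<in> span G" "b \<in> span G"
  shows "a * b \<in> span G"
proof -
  have g: "g * b \<in> span G" if "g \<in> G" for g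
    using assms(2)
    by (induction rule: span_induct_alt)
      (auto simp: distrib_left span_zero intro!: span_add span_scale span_base[OF mult_in] that)
  show ?thesis
    using assms(1)
    by (induction rule: span_induct_alt)
      (auto simp: distrib_right span_zero intro!: span_add span_scale g)
qed

lemma app_mem_cyclic_space: "a \<in> span G \<Longrightarrow> w \<in> cyclic_space \<Longrightarrow> app a w \<in> cyclic_space"
  unfolding cyclic_space_def by (auto simp flip: app_mult intro!: imageI span_mult)

lemma u_in_cyclic_space: "u \<in> cyclic_space"
  unfolding cyclic_space_def by (rule image_eqI[of _ _ 1]) (auto intro: span_base one_in)

lemma orb_subset_cyclic_space: "orb \<subseteq> cyclic_space"
  unfolding orb_def cyclic_space_def by (auto intro: span_base)

lemma subspace_cyclic_space: "subspace cyclic_space"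
  unfolding cyclic_space_def
  by (intro linear_subspace_image bounded_linear.linear[OF app.bounded_linear_left] subspace_span)

text \<open>The exponential of \<open>a\<close> is a limit of polynomials in \<open>a\<close>, and a subspace is closed.\<close>

lemma app_exp_mem_cyclic_space:
  assumes "a \<in> span G" "w \<in> cyclic_space"
  shows "app (exp a) w \<in> cyclic_space"
proof -
  have pow: "app (a ^ n) w \<in> cyclic_space" for n
    by (induction n) (auto simp: assms app_mem_cyclic_space)
  have "(\<lambda>n. \<Sum>i<n. a ^ i /\<^sub>R fact i) \<longlonglongrightarrow> exp a"
    using summable_LIMSEQ[OF summable_exp_generic[of a]] by (simp add: exp_def)
  from bounded_linear.tendsto[OF app.bounded_linear_left this]
  have lim: "(\<lambda>n. app (\<Sum>i<n. a ^ i /\<^sub>R fact i) w) \<longlonglongrightarrow> app (exp a) w" .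
  have "app (\<Sum>i<n. a ^ i /\<^sub>R fact i) w \<in> cyclic_space" for n
    unfolding app.sum_left app.scaleR_left
    by (intro subspace_sum subspace_scale subspace_cyclic_space pow)
  from closed_sequentially[OF closed_subspace[OF subspace_cyclic_space] this lim] show ?thesis .
qed

lemma bounded_linear_M: "bounded_linear M"
  using linear_M linear_conv_bounded_linear by blast

sublocale M: bounded_linear M
  by (rule bounded_linear_M)

text \<open>A linear projection of the ambient space onto \<^const>\<open>cyclic_space\<close>.\<close>

abbreviation proj :: "'a \<Rightarrow> 'a"
  where "proj x \<equiv> app (M x) u"

lemma proj_in_cyclic_space: "proj x \<in> cyclic_space"
  unfolding cyclic_space_def using M_in by blast

lemma proj_ident: "w \<in> cyclic_space \<Longrightarrow> proj w = w"
  unfolding cyclic_space_def using M_right_inverse by auto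

lemma bounded_linear_proj: "bounded_linear proj"
  using bounded_linear_compose[OF app.bounded_linear_left M.bounded_linear_axioms] .

lemma M_commute: "M x * M y = M y * M x"
  by (intro span_commute M_in)

lemma exp_M_cancel: "exp (M x) * exp (- M x) = 1" "exp (- M x) * exp (M x) = 1"
  using exp_minus_inverse[of "M x"] exp_minus_inverse[of "- M x"] by simp_all

lemma app_exp_M_cancel:
  "app (exp (M x)) (app (exp (- M x)) w) = w"
  using exp_M_cancel(1)[of x] by (metis app_mult app_one)

text \<open>An element of the algebra is determined on the cyclic space by its value at \<open>u\<close>: a vector of
  the cyclic space is \<open>app b u\<close> with \<open>b\<close> in the algebra, and \<open>b\<close> commutes with \<open>a\<close> and with all of \<open>M\<close>.\<close>

lemma app_M_eqI:
  assumes "w \<in> cyclic_space" "proj z = app a (proj v)" "\<And>b. b \<in> span G \<Longrightarrow> a * b = b * a"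
  shows "app (M z) w = app a (app (M v) w)"
proof -
  obtain b where b: "b \<in> span G" "w = app b u"
    using assms(1) unfolding cyclic_space_def by blast
  have "app (M z) w = app b (proj z)"
    by (simp add: b flip: app_mult span_commute[OF b(1) M_in])
  also have "\<dots> = app (a * (M v * b)) u"
    by (simp add: assms(2) flip: app_mult assms(3)[OF b(1)] span_commute[OF b(1) M_in] mult.assoc)
  finally show ?thesis by (simp add: b)
qed

text \<open>On the cyclic space this is \<open>x \<mapsto> exp (M x) u\<close>, the exponential map of the algebra transported
  by evaluation; on the kernel of the projection it is a translation. Its local inverse is therefore
  a logarithm, which straightens the orbit.\<close>

definition Phi :: "'a \<Rightarrow> 'a"
  where "Phi x = app (exp (M x)) u + (x - proj x)"

definition Phi' :: "'a \<Rightarrow> 'a \<Rightarrow>\<^sub>L 'a"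
  where "Phi' x = id_blinfun + (blinfun_of_endo (exp (M x) - 1) o\<^sub>L Blinfun proj)"

lemma Phi'_apply: "blinfun_apply (Phi' x) v = v + app (exp (M x) - 1) (proj v)"
  by (simp add: Phi'_def blinfun.bilinear_simps bounded_linear_Blinfun_apply[OF bounded_linear_proj]
      flip: app.rep_eq)

lemma has_derivative_exp_M:
  "((\<lambda>x. exp (M x)) has_derivative (\<lambda>v. exp (M x) * M v)) (at x)"
  by (rule has_derivative_exp_commuting[OF bounded_linear_M M_commute])

lemma continuous_on_exp_M: "continuous_on S (\<lambda>x. exp (M x))"
  using has_derivative_continuous[OF has_derivative_exp_M]
  by (auto intro: continuous_at_imp_continuous_on)

lemma has_derivative_Phi: "(Phi has_derivative Phi' x) (at x)"
proof -
  have "((\<lambda>x. app (exp (M x)) u + (x - proj x)) has_derivative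
      (\<lambda>v. app (exp (M x) * M v) u + (v - proj v))) (at x)"
    by (intro has_derivative_add has_derivative_diff has_derivative_ident
        bounded_linear.has_derivative[OF app.bounded_linear_left] has_derivative_exp_M
        bounded_linear_imp_has_derivative bounded_linear_M)
  then show ?thesis
    by (simp add: Phi_def[abs_def] Phi'_apply[abs_def] app.diff_left algebra_simps)
qed

lemma continuous_on_Phi: "continuous_on S Phi"
  using has_derivative_continuous[OF has_derivative_Phi]
  by (auto intro: continuous_at_imp_continuous_on)

lemma continuous_on_Phi': "continuous_on S Phi'"
  unfolding Phi'_def[abs_def]
  by (intro continuous_intros bounded_linear.continuous_on[OF bounded_linear_blinfun_of_endo]
      continuous_on_exp_M)

lemma Phi_0: "Phi 0 = u"
  by (simp add: Phi_def)

text \<open>Applying the projection to \<open>Phi' x w = v\<close> gives \<open>exp (M x) (proj w) = proj v\<close>, because \<open>exp (M x)\<close>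
  preserves the cyclic space; this determines \<open>proj w\<close> and then \<open>w\<close>.\<close>

lemma inv_Phi':
  "inv_into UNIV (blinfun_apply (Phi' x)) v = v - proj v + app (exp (- M x)) (proj v)"
  if bij: "bij (blinfun_apply (Phi' x))"
proof (rule inv_f_eq)
  show "inj (blinfun_apply (Phi' x))" using bij by (rule bij_is_inj)
  have "app (exp (- M x)) (proj v) \<in> cyclic_space"
    using app_exp_mem_cyclic_space[OF span_neg[OF M_in] proj_in_cyclic_space] .
  then have "proj (v - proj v + app (exp (- M x)) (proj v)) = app (exp (- M x)) (proj v)"
    using proj_ident[OF proj_in_cyclic_space] proj_ident by (simp add: M.add M.diff app.bilinear_simps)
  then show "blinfun_apply (Phi' x) (v - proj v + app (exp (- M x)) (proj v)) = v"
    by (simp add: Phi'_apply app.diff_left app_exp_M_cancel)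
qed

lemma Ck_on_exp_M: "Ck_on k UNIV (\<lambda>x. app (exp (M x)) w)"
proof (induction k arbitrary: w)
  case 0
  then show ?case
    by (simp add: bounded_linear.continuous_on[OF app.bounded_linear_left] continuous_on_exp_M)
next
  case (Suc k)
  show ?case
  proof (rule Ck_on_Suc_has_derivativeI)
    show "((\<lambda>x. app (exp (M x)) w) has_derivative (\<lambda>v. app (exp (M x)) (app (M v) w))) (at x)" for x
      using bounded_linear.has_derivative[OF app.bounded_linear_left has_derivative_exp_M, of w]
      by simp
  qed (use Suc in auto)
qed

lemma smooth_on_Phi: "smooth_on W Phi"
proof -
  have "bounded_linear (\<lambda>x. x - proj x)"
    by (rule bounded_linear_sub[OF bounded_linear_ident bounded_linear_proj])
  then have "Ck_on k UNIV (\<lambda>x. app (exp (M x)) u + (x - proj x))" for k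
    by (rule Ck_on_add[OF open_UNIV Ck_on_exp_M Ck_on_bounded_linear])
  then show ?thesis
    unfolding smooth_on_def Phi_def[abs_def] using Ck_on_subset[OF _ subset_UNIV] by blast
qed

lemma Phi_inverse:
  obtains V U h where "open V" "0 \<in> V" "open U" "homeomorphism V U Phi h"
    "\<And>y. y \<in> U \<Longrightarrow>
      (h has_derivative (\<lambda>v. v - proj v + app (exp (- M (h y))) (proj v))) (at y)"
proof -
  have inv0: "id_blinfun o\<^sub>L Phi' 0 = id_blinfun"
    by (rule blinfun_eqI) (simp add: Phi'_apply)
  obtain V U h h' where V: "open V" "0 \<in> V" "open U" "homeomorphism V U Phi h"
    and h: "\<And>y. y \<in> U \<Longrightarrow> (h has_derivative (h' y)) (at y)"
      "\<And>y. y \<in> U \<Longrightarrow> h' y = inv_into UNIV (blinfun_apply (Phi' (h y)))"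
      "\<And>y. y \<in> U \<Longrightarrow> bij (blinfun_apply (Phi' (h y)))"
    by (rule inverse_function_theorem[OF open_UNIV has_derivative_Phi continuous_on_Phi' UNIV_I inv0])
      blast
  have h': "h' y = (\<lambda>v. v - proj v + app (exp (- M (h y))) (proj v))" if "y \<in> U" for y
    unfolding h(2)[OF that] using inv_Phi'[OF h(3)[OF that]] by blast
  show ?thesis
    using that[OF V] h(1) h' by force
qed

text \<open>The logarithm \<open>h\<close> is smooth because its derivative is expressed by \<open>exp (- M (h y))\<close>, and
  the derivative of \<open>exp (- c M (h y)) w\<close> in direction \<open>v\<close> is \<open>- c exp (- (c + 1) M (h y)) (M v w)\<close>, an
  expression of the same kind. Allowing every real \<open>c\<close> thus makes the induction over the order of
  differentiability go through with neither a product rule nor smoothness of inversion.\<close>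

lemma smooth_on_inverse:
  assumes "open U"
    and der: "\<And>y. y \<in> U \<Longrightarrow>
      (h has_derivative (\<lambda>v. v - proj v + app (exp (- M (h y))) (proj v))) (at y)"
  shows "smooth_on U h"
proof -
  have cont: "continuous_on U h"
    using has_derivative_continuous[OF der] by (auto intro: continuous_at_imp_continuous_on)
  have exp_h: "Ck_on k U (\<lambda>y. app (exp (- (c *\<^sub>R M (h y)))) w)" if "w \<in> cyclic_space" for k c w
    using that
  proof (induction k arbitrary: c w)
    case 0
    have "continuous_on U (\<lambda>y. exp (M (- c *\<^sub>R h y)))"
      by (intro continuous_on_compose2[OF continuous_on_exp_M[of UNIV]] continuous_intros cont) auto
    then show ?case
      by (simp add: bounded_linear.continuous_on[OF app.bounded_linear_left] M.scaleR M.neg)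
  next
    case (Suc k)
    show ?case
    proof (rule Ck_on_Suc_has_derivativeI[OF \<open>open U\<close>])
      fix y assume y: "y \<in> U"
      let ?D = "\<lambda>v. v - proj v + app (exp (- M (h y))) (proj v)"
      have "((\<lambda>y. exp (M (- c *\<^sub>R h y))) has_derivative
          (\<lambda>v. exp (M (- c *\<^sub>R h y)) * M (- c *\<^sub>R ?D v))) (at y)"
        by (rule has_derivative_compose[OF has_derivative_scaleR_right[OF der[OF y]] has_derivative_exp_M])
      from bounded_linear.has_derivative[OF app.bounded_linear_left this, of w]
      have *: "((\<lambda>y. app (exp (- (c *\<^sub>R M (h y)))) w) has_derivative
          (\<lambda>v. app (exp (- (c *\<^sub>R M (h y))) * M (- c *\<^sub>R ?D v)) w)) (at y)"
        by (simp add: M.scaleR M.neg)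
      have "app (exp (- (c *\<^sub>R M (h y))) * M (- c *\<^sub>R ?D v)) w
          = (- c) *\<^sub>R app (exp (- ((c + 1) *\<^sub>R M (h y)))) (app (M v) w)" for v
      proof -
        have mem: "app (exp (- M (h y))) (proj v) \<in> cyclic_space"
          using app_exp_mem_cyclic_space[OF span_neg[OF M_in] proj_in_cyclic_space] .
        have "proj (?D v) = app (exp (- M (h y))) (proj v)"
          using proj_ident[OF mem] proj_ident[OF proj_in_cyclic_space] by (simp add: M.add M.diff app.bilinear_simps)
        then have "app (M (?D v)) w = app (exp (- M (h y))) (app (M v) w)"
          by (rule app_M_eqI[OF Suc.prems]) (intro exp_commute span_commute span_neg M_in)
        moreover have "exp (- (c *\<^sub>R M (h y))) * exp (- M (h y)) = exp (- ((c + 1) *\<^sub>R M (h y)))"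
          by (subst exp_add_commuting[symmetric]) (simp_all add: algebra_simps)
        moreover have "app (exp (- (c *\<^sub>R M (h y))) * M (- c *\<^sub>R d)) w
            = (- c) *\<^sub>R app (exp (- (c *\<^sub>R M (h y)))) (app (M d) w)" for d
          by (simp add: M.scaleR M.neg app.bilinear_simps)
        ultimately show ?thesis
          by (metis app_mult)
      qed
      with * show "((\<lambda>y. app (exp (- (c *\<^sub>R M (h y)))) w) has_derivative
          (\<lambda>v. (- c) *\<^sub>R app (exp (- ((c + 1) *\<^sub>R M (h y)))) (app (M v) w))) (at y)"
        by simp
    next
      show "Ck_on k U (\<lambda>y. (- c) *\<^sub>R app (exp (- ((c + 1) *\<^sub>R M (h y)))) (app (M v) w))" for v
        by (rule Ck_on_bounded_linear_compose[OF \<open>open U\<close> bounded_linear_scaleR_right])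
          (rule Suc.IH[OF app_mem_cyclic_space[OF M_in Suc.prems]])
    qed
  qed
  have "Ck_on k U h" for k
  proof (cases k)
    case 0
    then show ?thesis using cont by simp
  next
    case (Suc j)
    show ?thesis
      unfolding Suc
    proof (rule Ck_on_Suc_has_derivativeI[OF \<open>open U\<close> der])
      show "Ck_on j U (\<lambda>y. v - proj v + app (exp (- M (h y))) (proj v))" for v
        using exp_h[OF proj_in_cyclic_space, of j 1 v] by (intro Ck_on_add \<open>open U\<close> Ck_on_const) simp
    qed
  qed
  then show ?thesis by (simp add: smooth_on_def)
qed

definition log_orb :: "'a set"
  where "log_orb = {x \<in> cyclic_space. app (exp (M x)) u \<in> orb}"

lemma zero_in_log_orb: "0 \<in> log_orb"
  using one_in by (auto simp: log_orb_def orb_def subspace_0[OF subspace_cyclic_space] intro: image_eqI[of _ _ 1])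

text \<open>If \<open>exp (M x) u = g u\<close> and \<open>exp (M y) u = h u\<close> with \<open>g\<close> and \<open>h\<close> in \<open>G\<close>, then by commutativity
  \<open>exp (M (x - y)) u = g h\<^sup>-\<^sup>1 u\<close>. So the logarithms of the orbit form an additive group.\<close>

lemma log_orb_diff:
  assumes "x \<in> log_orb" "y \<in> log_orb"
  shows "x - y \<in> log_orb"
proof -
  obtain g h where g: "g \<in> G" "app (exp (M x)) u = app g u"
    and h: "h \<in> G" "app (exp (M y)) u = app h u"
    using assms unfolding log_orb_def orb_def by auto
  obtain k where k: "k \<in> G" "k * h = 1"
    using inverse_in[OF h(1)] by blast
  have comm: "exp (- M y) * b = b * exp (- M y)" if "b \<in> G" for b
    by (intro exp_commute span_commute span_neg M_in span_base that)
  have "app h (app (exp (- M y)) u) = u"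
    using exp_M_cancel(2)[of y] by (metis app_mult app_one comm[OF h(1)] h(2))
  then have inv: "app (exp (- M y)) u = app k u"
    by (metis app_mult app_one k(2))
  have "exp (M (x - y)) = exp (- M y) * exp (M x)"
    using exp_add_commuting[of "- M y" "M x"] M_commute[of y x] by (simp add: M.diff)
  then have "app (exp (M (x - y))) u = app (g * k) u"
    using g inv by (metis app_mult comm[OF g(1)])
  then have "app (exp (M (x - y))) u \<in> orb"
    unfolding orb_def using mult_in[OF g(1) k(1)] by blast
  then show ?thesis
    using assms by (simp add: log_orb_def subspace_diff[OF subspace_cyclic_space])
qed

lemma Phi_in_orb_iff: "Phi x \<in> orb \<longleftrightarrow> x \<in> log_orb"
proof -
  have e: "app (exp (M x)) u \<in> cyclic_space"
    by (rule app_exp_mem_cyclic_space[OF M_in u_in_cyclic_space])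
  have "Phi x \<in> cyclic_space \<longleftrightarrow> x \<in> cyclic_space"
  proof
    assume "Phi x \<in> cyclic_space"
    then have "Phi x - app (exp (M x)) u + proj x \<in> cyclic_space"
      by (intro subspace_add[OF subspace_cyclic_space] subspace_diff[OF subspace_cyclic_space] e proj_in_cyclic_space)
    then show "x \<in> cyclic_space" by (simp add: Phi_def)
  qed (simp add: Phi_def proj_ident e)
  moreover have "Phi x = app (exp (M x)) u" if "x \<in> cyclic_space"
    using that by (simp add: Phi_def proj_ident)
  ultimately show ?thesis
    using orb_subset_cyclic_space unfolding log_orb_def by auto
qed

text \<open>In the coordinates of \<^const>\<open>Phi\<close> the orbit is the additive group \<^const>\<open>log_orb\<close>. A homeomorphism of
  open sets respects closures, so in these coordinates the closure of the orbit is the closure of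
  that group, a closed subgroup, and near 0 a closed subgroup is a subspace.\<close>

lemma chart_at_base_point:
  obtains U V S and h h' :: "'a \<Rightarrow> 'a" where "open U" "u \<in> U" "open V" "homeomorphism U V h h'"
    "smooth_on U h" "smooth_on V h'" "subspace S" "h ` (U \<inter> closure orb) = V \<inter> S"
proof -
  obtain V0 U0 h where V0: "open V0" "0 \<in> V0" and U0: "open U0"
    and hom: "homeomorphism V0 U0 Phi h"
    and der: "\<And>y. y \<in> U0 \<Longrightarrow>
      (h has_derivative (\<lambda>v. v - proj v + app (exp (- M (h y))) (proj v))) (at y)"
    using Phi_inverse by blast
  have hom_simps: "x \<in> V0 \<Longrightarrow> h (Phi x) = x" "x \<in> V0 \<Longrightarrow> Phi x \<in> U0"
      "y \<in> U0 \<Longrightarrow> Phi (h y) = y" "y \<in> U0 \<Longrightarrow> h y \<in> V0" for x y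
    using hom unfolding homeomorphism_def by auto
  have cont: "continuous_on U0 h" using hom by (simp add: homeomorphism_def)
  have closure_diff: "x - y \<in> closure log_orb" if "x \<in> closure log_orb" "y \<in> closure log_orb" for x y
  proof -
    have "(\<lambda>p. fst p - snd p) ` closure (log_orb \<times> log_orb) \<subseteq> closure log_orb"
      by (rule image_closure_subset)
        (auto intro!: continuous_intros log_orb_diff closure_subset[THEN subsetD])
    with that show ?thesis by (force simp: closure_Times)
  qed
  obtain S e where S: "subspace S" "0 < e" "closure log_orb \<inter> ball 0 e = S \<inter> ball 0 e"
    using closed_subgroup_subspace_near_0[OF closed_closure _ closure_diff] zero_in_log_orb
      closure_subset by blast
  have closure_iff: "Phi x \<in> closure orb \<longleftrightarrow> x \<in> closure log_orb" if x: "x \<in> V0" for x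
  proof
    assume "x \<in> closure log_orb"
    moreover have "Phi ` closure log_orb \<subseteq> closure orb"
      by (rule image_closure_subset[OF continuous_on_Phi])
        (use Phi_in_orb_iff closure_subset in auto)
    ultimately show "Phi x \<in> closure orb" by blast
  next
    assume clo: "Phi x \<in> closure orb"
    show "x \<in> closure log_orb"
    proof (rule ccontr)
      assume x': "x \<notin> closure log_orb"
      define B where "B = U0 \<inter> h -` (- closure log_orb)"
      have "open B"
        unfolding B_def by (intro continuous_open_preimage cont U0) auto
      moreover have "Phi x \<in> B"
        using x x' by (simp add: B_def hom_simps)
      ultimately have "B \<inter> orb \<noteq> {}"
        using clo open_Int_closure_eq_empty[of B orb] by blast
      then obtain y where y: "y \<in> U0" "h y \<notin> closure log_orb" "y \<in> orb"
        unfolding B_def by blast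
      then have "h y \<in> log_orb"
        using Phi_in_orb_iff[of "h y"] by (simp add: hom_simps)
      with y(2) closure_subset show False by blast
    qed
  qed
  define V where "V = V0 \<inter> ball 0 e"
  define U where "U = U0 \<inter> h -` ball 0 e"
  have opU: "open U"
    unfolding U_def by (intro continuous_open_preimage cont U0) auto
  show thesis
  proof (rule that)
    show "open U" by (rule opU)
    show "u \<in> U"
      using hom_simps(1,2)[OF V0(2)] S(2) by (simp add: U_def Phi_0)
    show "open V" using V0 by (auto simp: V_def)
    show "homeomorphism U V h Phi"
      by (rule homeomorphismI)
        (auto simp: U_def V_def hom_simps intro: continuous_on_Phi continuous_on_subset[OF cont])
    show "smooth_on U h"
      by (rule smooth_on_inverse[OF opU der]) (simp add: U_def)
    show "smooth_on V Phi" by (rule smooth_on_Phi)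
    show "subspace S" by (rule S)
    have "h ` (U \<inter> closure orb) = V \<inter> closure log_orb"
    proof
      show "h ` (U \<inter> closure orb) \<subseteq> V \<inter> closure log_orb"
        by (auto simp: U_def V_def hom_simps simp flip: closure_iff)
      show "V \<inter> closure log_orb \<subseteq> h ` (U \<inter> closure orb)"
      proof
        fix x assume "x \<in> V \<inter> closure log_orb"
        then have "Phi x \<in> U \<inter> closure orb" "h (Phi x) = x"
          by (auto simp: U_def V_def hom_simps closure_iff)
        then show "x \<in> h ` (U \<inter> closure orb)" by (metis imageI)
      qed
    qed
    then show "h ` (U \<inter> closure orb) = V \<inter> S"
      using S(3) unfolding V_def by blast
  qed
qed

end

section \<open>Regularity of abelian orbits\<close>

text \<open>One chart at \<open>u\<close> is enough: an element \<open>g\<close> of \<open>G\<close> is a linear automorphism of the ambient space that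
  preserves the orbit and hence its closure, so it carries the chart at \<open>u\<close> to a chart at \<open>g u\<close>. This
  also shows that the dimension is the same at every point of the orbit.\<close>

lemma abelian_endo_group_orbit_regular:
  fixes G :: "'a::euclidean_space endo set" and u :: 'a
  assumes one_in: "1 \<in> G"
    and mult_in: "\<And>g h. g \<in> G \<Longrightarrow> h \<in> G \<Longrightarrow> g * h \<in> G"
    and inverse_in: "\<And>g. g \<in> G \<Longrightarrow> \<exists>h\<in>G. h * g = 1"
    and commute: "\<And>g h. g \<in> G \<Longrightarrow> h \<in> G \<Longrightarrow> g * h = h * g"
  shows "\<exists>m\<le>DIM('a). regular_of_order m ((\<lambda>g. app g u) ` G)"
proof -
  have "linear (\<lambda>a. app a u)"
    using app.bounded_linear_left by (rule bounded_linear.linear)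
  from linear_exists_right_inverse_on[OF this subspace_span[of G]]
  obtain M where M: "range M \<subseteq> span G" "linear M"
      "\<forall>v\<in>(\<lambda>a. app a u) ` span G. app (M v) u = v"
    by blast
  interpret abelian_orbit G u M
    by (rule abelian_orbit.intro) (use assms M in \<open>simp_all add: image_subset_iff\<close>)
  obtain U V S and h h' :: "'a \<Rightarrow> 'a" where U: "open U" "u \<in> U" and V: "open V"
    and hom: "homeomorphism U V h h'" and h: "smooth_on U h" and h': "smooth_on V h'"
    and S: "subspace S" and chart: "h ` (U \<inter> closure orb) = V \<inter> S"
    by (rule chart_at_base_point) blast
  have closure_invariant: "app g x \<in> closure orb" if "g \<in> G" "x \<in> closure orb" for g x
  proof -
    have "app g ` orb \<subseteq> orb"
      unfolding orb_def using mult_in[OF \<open>g \<in> G\<close>] by (auto simp flip: app_mult)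
    then have "app g ` closure orb \<subseteq> closure orb"
      by (intro image_closure_subset linear_continuous_on app.bounded_linear_right)
        (auto intro: closure_subset[THEN subsetD])
    with that(2) show ?thesis by blast
  qed
  have "regular_of_order (dim S) orb"
    unfolding regular_of_order_def
  proof
    fix v assume "v \<in> orb"
    then obtain g where g: "g \<in> G" "v = app g u" unfolding orb_def by blast
    obtain k where k: "k \<in> G" "k * g = 1" using inverse_in[OF g(1)] by blast
    have "g * k = 1" using commute[OF g(1) k(1)] k(2) by simp
    then have cancel: "app k (app g x) = x" "app g (app k x) = x" for x
      using k(2) by (metis app_mult app_one)+
    have lin: "bounded_linear (app g)" "bounded_linear (app k)"
      by (rule app.bounded_linear_right)+
    define W where "W = app k -` U"
    have W: "open W"
      unfolding W_def by (intro open_vimage U linear_continuous_on lin)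
    have "homeomorphism W V (\<lambda>x. h (app k x)) (\<lambda>y. app g (h' y))"
    proof -
      have "homeomorphism W U (app k) (app g)"
        by (rule homeomorphismI) (auto simp: W_def cancel intro!: linear_continuous_on lin)
      from homeomorphism_compose[OF this hom] show ?thesis
        by (simp add: o_def)
    qed
    moreover have "smooth_on W (\<lambda>x. h (app k x))"
      using h Ck_on_compose_bounded_linear[OF U(1) lin(2), where f = h] by (simp add: smooth_on_def W_def)
    moreover have "smooth_on V (\<lambda>y. app g (h' y))"
      using h' Ck_on_bounded_linear_compose[OF V lin(1), where f = h'] by (simp add: smooth_on_def)
    moreover have "(\<lambda>x. h (app k x)) ` (W \<inter> (closure orb \<inter> W)) = V \<inter> S"
    proof -
      have "app k ` (W \<inter> closure orb) = U \<inter> closure orb"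
      proof
        show "app k ` (W \<inter> closure orb) \<subseteq> U \<inter> closure orb"
          by (auto simp: W_def closure_invariant[OF k(1)])
        show "U \<inter> closure orb \<subseteq> app k ` (W \<inter> closure orb)"
        proof
          fix x assume "x \<in> U \<inter> closure orb"
          then have "app g x \<in> W \<inter> closure orb"
            by (simp add: W_def cancel closure_invariant[OF g(1)])
          then show "x \<in> app k ` (W \<inter> closure orb)" by (metis cancel(1) imageI)
        qed
      qed
      then have "h ` app k ` (W \<inter> closure orb) = V \<inter> S"
        using chart by simp
      then show ?thesis
        by (simp add: image_image Int_commute Int_left_commute)
    qed
    ultimately have "manifold_of_dim (dim S) (closure orb \<inter> W)"
      unfolding manifold_of_dim_def using W V S by blast
    moreover have "v \<in> W"
      using U(2) g(2) by (simp add: W_def cancel)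
    ultimately show "\<exists>W. open W \<and> v \<in> W \<and> manifold_of_dim (dim S) (closure orb \<inter> W)"
      using W by blast
  qed
  then show ?thesis
    using dim_subset_UNIV[of S] unfolding orb_def by blast
qed

section \<open>Abelian matrix groups\<close>

lemma linear_matrix_vector_mult:
  fixes A :: "'k::{field, real_algebra} ^ 'n ^ 'm"
  shows "linear ((*v) A)"
  by (rule linearI)
    (simp_all add: vec_eq_iff matrix_vector_mult_def scaleR_sum_right
      distrib_left sum.distrib)

lemma abelian_matrix_group_orbit_regular:
  fixes G :: "('k::{field, real_algebra, euclidean_space} ^ 'n ^ 'n) set" and u :: "'k ^ 'n"
  assumes sub: "subgroup G general_linear" and comm: "comm_group (general_linear\<lparr>carrier := G\<rparr>)"
  shows "\<exists>m\<le>DIM('k ^ 'n). regular_of_order m (orbit G u)"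
proof -
  define e :: "'k ^ 'n ^ 'n \<Rightarrow> ('k ^ 'n) endo"
    where "e A = endo_of_blinfun (Blinfun ((*v) A))" for A
  have app_e: "app (e A) x = A *v x" for A x
    using linear_matrix_vector_mult[of A]
    by (simp add: e_def app.abs_eq bounded_linear_Blinfun_apply linear_conv_bounded_linear)
  have e_mult: "e A * e B = e (A ** B)" for A B
    by (rule endo_eqI) (simp add: app_e matrix_vector_mul_assoc)
  have e_one: "e (mat 1) = 1"
    by (rule endo_eqI) (simp add: app_e)
  interpret subgroup G general_linear by (rule sub)
  interpret GL: group "general_linear :: ('k ^ 'n ^ 'n) monoid" by (rule group_general_linear)
  interpret G: comm_group "general_linear\<lparr>carrier := G\<rparr>" by (rule comm)
  have orbit: "orbit G u = (\<lambda>g. app g u) ` e ` G"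
    by (auto simp: orbit_def app_e image_image)
  have "\<exists>m\<le>DIM('k ^ 'n). regular_of_order m ((\<lambda>g. app g u) ` e ` G)"
  proof (rule abelian_endo_group_orbit_regular)
    show "1 \<in> e ` G"
      using one_closed e_one by (force simp: general_linear_def)
    fix a assume "a \<in> e ` G"
    then obtain A where A: "A \<in> G" "a = e A" by blast
    show "\<exists>h\<in>e ` G. h * a = 1"
    proof
      have "inv\<^bsub>general_linear\<^esub> A ** A = mat 1"
        using GL.l_inv[OF mem_carrier[OF A(1)]] by (simp add: general_linear_def)
      then show "e (inv\<^bsub>general_linear\<^esub> A) * a = 1"
        by (simp add: A e_mult e_one)
    qed (use A in simp)
    fix b assume "b \<in> e ` G"
    then obtain B where B: "B \<in> G" "b = e B" by blast
    show "a * b \<in> e ` G"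
      using m_closed[OF A(1) B(1)] by (simp add: A B e_mult general_linear_def)
    show "a * b = b * a"
      using G.m_comm[of A B] A B by (simp add: e_mult general_linear_def)
  qed
  then show ?thesis by (simp add: orbit)
qed

theorem corollary1p3:
  shows "(\<forall>(G :: (complex ^ 'n ^ 'n) set) (u :: complex ^ 'n).
            subgroup G general_linear \<and> comm_group (general_linear\<lparr>carrier := G\<rparr>) \<longrightarrow>
            (\<exists>m. 0 \<le> m \<and> m \<le> 2 * CARD('n) \<and> regular_of_order m (orbit G u)))
       \<and> (\<forall>(G :: (real ^ 'n ^ 'n) set) (u :: real ^ 'n).
            subgroup G general_linear \<and> comm_group (general_linear\<lparr>carrier := G\<rparr>) \<longrightarrow>
            (\<exists>m. 0 \<le> m \<and> m \<le> CARD('n) \<and> regular_of_order m (orbit G u)))"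
  using abelian_matrix_group_orbit_regular[where 'k = complex and 'n = 'n]
    abelian_matrix_group_orbit_regular[where 'k = real and 'n = 'n]
  by (simp add: mult.commute)

end
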